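(* For every integer $n\ge 1$, $$|RAI_{2n+1}(2431,4132)|=|AI_{2n+1}(3241,4213)|=\left\lfloor \frac{2^{n-1}\cdot 5}{3}\right\rfloor.$$
   Context: Let $S_n$ be the set of permutations $\pi=\pi_1\ldots\pi_n$ of $\{1,\ldots,n\}$. A permutation is alternating if, for all $1\le i\le n-1$, $\pi_i<\pi_{i+1}$ if and only if $i$ is odd; it is reverse alternating if, for all $1\le i\le n-1$, $\pi_i>\pi_{i+1}$ if and only if $i$ is odd. $AI_n$ (resp. $RAI_n$) is the set of alternating (resp. reverse alternating) involutions ($\pi=\pi^{-1}$) in $S_n$. A permutation $\pi\in S_n$ avoids the pattern $\tau\in S_k$ if there are no indices $i_1<\cdots<i_k$ such that $\pi_{i_1}\ldots\pi_{i_k}$ is order-isomorphic to $\tau$; $AI_n(\sigma,\tau)$ and $RAI_n(\sigma,\tau)$ are the subsets of elements avoiding both $\sigma$ and $\tau$. (Since $4132=2431^{-1}$ and $4213=3241^{-1}$, for involutions avoiding both patterns of a pair is the same as avoiding either one.) *)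

theory Defs
  imports Complex_Main "HOL-Combinatorics.Permutations"
begin

text \<open>
  A permutation of \<open>{1..n}\<close> is a function \<open>\<pi>\<close> with \<open>\<pi> permutes {1..n}\<close> (so it is the
  identity outside \<open>{1..n}\<close>); its one-line notation is \<open>\<pi> 1 \<dots> \<pi> n\<close>.
\<close>

definition alternating :: "nat \<Rightarrow> (nat \<Rightarrow> nat) \<Rightarrow> bool" where
  "alternating n \<pi> \<longleftrightarrow> (\<forall>i\<in>{1..<n}. \<pi> i < \<pi> (i + 1) \<longleftrightarrow> odd i)"

definition reverse_alternating :: "nat \<Rightarrow> (nat \<Rightarrow> nat) \<Rightarrow> bool" where
  "reverse_alternating n \<pi> \<longleftrightarrow> (\<forall>i\<in>{1..<n}. \<pi> i > \<pi> (i + 1) \<longleftrightarrow> odd i)"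

definition involutions :: "nat \<Rightarrow> (nat \<Rightarrow> nat) set" where
  "involutions n = {\<pi>. \<pi> permutes {1..n} \<and> \<pi> = inv \<pi>}"

text \<open>
  A pattern is given by its one-line notation as a list, e.g. \<open>[2, 4, 3, 1]\<close>. List positions
  count from 0, so \<open>i\<close> below lists positions \<open>i 0 < \<dots> < i (k - 1)\<close> in \<open>{1..n}\<close>, where
  \<open>k\<close> is the length of the pattern.
\<close>

definition avoids :: "nat \<Rightarrow> (nat \<Rightarrow> nat) \<Rightarrow> nat list \<Rightarrow> bool" where
  "avoids n \<pi> \<tau> \<longleftrightarrow>
    \<not> (\<exists>i :: nat \<Rightarrow> nat.
         strict_mono_on {..<length \<tau>} i \<and> i ` {..<length \<tau>} \<subseteq> {1..n} \<and>
         (\<forall>a<length \<tau>. \<forall>b<length \<tau>. \<pi> (i a) < \<pi> (i b) \<longleftrightarrow> \<tau> ! a < \<tau> ! b))"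

definition AI :: "nat \<Rightarrow> nat list \<Rightarrow> nat list \<Rightarrow> (nat \<Rightarrow> nat) set" where
  "AI n \<sigma> \<tau> = {\<pi> \<in> involutions n. alternating n \<pi> \<and> avoids n \<pi> \<sigma> \<and> avoids n \<pi> \<tau>}"

definition RAI :: "nat \<Rightarrow> nat list \<Rightarrow> nat list \<Rightarrow> (nat \<Rightarrow> nat) set" where
  "RAI n \<sigma> \<tau> = {\<pi> \<in> involutions n. reverse_alternating n \<pi> \<and> avoids n \<pi> \<sigma> \<and> avoids n \<pi> \<tau>}"

end

theory Submission
  imports Defs
begin

text \<open>
  Reverse-complement exchanges the two families, so it suffices to count reverse alternating
  involutions \<open>\<pi>\<close> of odd length \<open>N\<close>. Then \<open>m = \<pi> 1\<close> is even, and \<open>\<pi> m = 1\<close>.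

  If \<open>\<pi>\<close> preserves \<open>{1..m}\<close>, then the entries after the leading \<open>m\<close> avoid 132, which together
  with the alternation forces the prefix \<open>m, m-2, m-1, \<dots>, 2, 3, 1\<close>; what follows is an arbitrary
  permutation of the same kind of length \<open>N - m\<close>.

  Otherwise some 2-cycles leave \<open>{1..m}\<close>. Following them to the right, alternation and the two
  patterns determine where each ends, and their number stays constant; since it is 1 at the right
  end, there is just one such cycle \<open>(i \<pi> i)\<close>. As before, the rest of the prefix is forced,
  which gives \<open>i = m/2 + 1\<close> and \<open>4 dvd m\<close>, and \<open>\<pi>\<close> is determined by \<open>m\<close> and \<open>N\<close>.

  Hence the numbers \<open>r n\<close> for length \<open>2 n + 1\<close> satisfy
  \<open>r n = r 0 + \<dots> + r (n - 1) + \<lfloor>n/2\<rfloor>\<close>.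
\<close>

section \<open>Patterns of length four\<close>

text \<open>Each pair is compared in both directions: \<open>\<pi>\<close> is not assumed injective,
  so one strict comparison does not settle the other. For a concrete pattern the conditions collapse
  to a chain of three inequalities.\<close>

lemma avoids_length_4:
  "avoids n \<pi> [p, q, r, s] \<longleftrightarrow>
    \<not> (\<exists>a b c d. 1 \<le> a \<and> a < b \<and> b < c \<and> c < d \<and> d \<le> n \<and>
      (\<pi> a < \<pi> b \<longleftrightarrow> p < q) \<and> (\<pi> b < \<pi> a \<longleftrightarrow> q < p) \<and>
      (\<pi> a < \<pi> c \<longleftrightarrow> p < r) \<and> (\<pi> c < \<pi> a \<longleftrightarrow> r < p) \<and>
      (\<pi> a < \<pi> d \<longleftrightarrow> p < s) \<and> (\<pi> d < \<pi> a \<longleftrightarrow> s < p) \<and>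
      (\<pi> b < \<pi> c \<longleftrightarrow> q < r) \<and> (\<pi> c < \<pi> b \<longleftrightarrow> r < q) \<and>
      (\<pi> b < \<pi> d \<longleftrightarrow> q < s) \<and> (\<pi> d < \<pi> b \<longleftrightarrow> s < q) \<and>
      (\<pi> c < \<pi> d \<longleftrightarrow> r < s) \<and> (\<pi> d < \<pi> c \<longleftrightarrow> s < r))" (is "_ \<longleftrightarrow> \<not> ?R")
proof -
  let ?ord = "\<lambda>i. \<forall>a<length [p, q, r, s]. \<forall>b<length [p, q, r, s].
    \<pi> (i a) < \<pi> (i b) \<longleftrightarrow> [p, q, r, s] ! a < [p, q, r, s] ! b"
  have four: "{..<length [p, q, r, s]} = {0, 1, 2, 3}" by auto
  show ?thesis
  proof (unfold avoids_def four, rule arg_cong[where f = Not], rule iffI)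
    assume "\<exists>i. strict_mono_on {0, 1, 2, 3} i \<and> i ` {0, 1, 2, 3} \<subseteq> {1..n} \<and> ?ord i"
    then obtain i :: "nat \<Rightarrow> nat" where mono: "strict_mono_on {0, 1, 2, 3} i"
      and ran: "i ` {0, 1, 2, 3} \<subseteq> {1..n}" and ord: "?ord i" by blast
    have "i 0 < i 1" "i 1 < i 2" "i 2 < i 3"
      using mono by (auto simp: strict_mono_on_def)
    moreover have "1 \<le> i 0" "i 3 \<le> n" using ran by auto
    moreover note ord[rule_format, of 0 1] ord[rule_format, of 1 0] ord[rule_format, of 0 2]
      ord[rule_format, of 2 0] ord[rule_format, of 0 3] ord[rule_format, of 3 0]
      ord[rule_format, of 1 2] ord[rule_format, of 2 1] ord[rule_format, of 1 3]
      ord[rule_format, of 3 1] ord[rule_format, of 2 3] ord[rule_format, of 3 2]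
    ultimately show ?R
      by (intro exI[of _ "i 0"] exI[of _ "i 1"] exI[of _ "i 2"] exI[of _ "i 3"] conjI) simp_all
  next
    assume ?R
    then obtain a b c d where h: "1 \<le> a" "a < b" "b < c" "c < d" "d \<le> n"
      "\<pi> a < \<pi> b \<longleftrightarrow> p < q" "\<pi> b < \<pi> a \<longleftrightarrow> q < p"
      "\<pi> a < \<pi> c \<longleftrightarrow> p < r" "\<pi> c < \<pi> a \<longleftrightarrow> r < p"
      "\<pi> a < \<pi> d \<longleftrightarrow> p < s" "\<pi> d < \<pi> a \<longleftrightarrow> s < p"
      "\<pi> b < \<pi> c \<longleftrightarrow> q < r" "\<pi> c < \<pi> b \<longleftrightarrow> r < q"
      "\<pi> b < \<pi> d \<longleftrightarrow> q < s" "\<pi> d < \<pi> b \<longleftrightarrow> s < q"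
      "\<pi> c < \<pi> d \<longleftrightarrow> r < s" "\<pi> d < \<pi> c \<longleftrightarrow> s < r"
      by (elim exE conjE) (rule that)
    define i where "i = (\<lambda>k::nat. if k = 0 then a else if k = 1 then b else if k = 2 then c else d)"
    have "strict_mono_on {0, 1, 2, 3} i" "i ` {0, 1, 2, 3} \<subseteq> {1..n}"
      using h(1-5) by (auto simp: strict_mono_on_def i_def)
    moreover have "?ord i"
    proof (intro allI impI)
      fix x y assume "x < length [p, q, r, s]" "y < length [p, q, r, s]"
      then have "x \<in> {0, 1, 2, 3}" "y \<in> {0, 1, 2, 3}" by auto
      then show "\<pi> (i x) < \<pi> (i y) \<longleftrightarrow> [p, q, r, s] ! x < [p, q, r, s] ! y"
        by (elim insertE emptyE) (simp_all add: i_def h(6-))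
    qed
    ultimately show "\<exists>i. strict_mono_on {0, 1, 2, 3} i \<and> i ` {0, 1, 2, 3} \<subseteq> {1..n} \<and> ?ord i"
      by blast
  qed
qed

lemma avoids_2431:
  "avoids n \<pi> [2, 4, 3, 1] \<longleftrightarrow>
    \<not> (\<exists>a b c d. 1 \<le> a \<and> a < b \<and> b < c \<and> c < d \<and> d \<le> n \<and> \<pi> d < \<pi> a \<and> \<pi> a < \<pi> c \<and> \<pi> c < \<pi> b)"
  unfolding avoids_length_4
  by (intro arg_cong[where f = Not] iff_exI, rule iffI; elim conjE; intro conjI) simp_all

lemma avoids_4132:
  "avoids n \<pi> [4, 1, 3, 2] \<longleftrightarrow>
    \<not> (\<exists>a b c d. 1 \<le> a \<and> a < b \<and> b < c \<and> c < d \<and> d \<le> n \<and> \<pi> b < \<pi> d \<and> \<pi> d < \<pi> c \<and> \<pi> c < \<pi> a)"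
  unfolding avoids_length_4
  by (intro arg_cong[where f = Not] iff_exI, rule iffI; elim conjE; intro conjI) simp_all

lemma avoids_3241:
  "avoids n \<pi> [3, 2, 4, 1] \<longleftrightarrow>
    \<not> (\<exists>a b c d. 1 \<le> a \<and> a < b \<and> b < c \<and> c < d \<and> d \<le> n \<and> \<pi> d < \<pi> b \<and> \<pi> b < \<pi> a \<and> \<pi> a < \<pi> c)"
  unfolding avoids_length_4
  by (intro arg_cong[where f = Not] iff_exI, rule iffI; elim conjE; intro conjI) simp_all

lemma avoids_4213:
  "avoids n \<pi> [4, 2, 1, 3] \<longleftrightarrow>
    \<not> (\<exists>a b c d. 1 \<le> a \<and> a < b \<and> b < c \<and> c < d \<and> d \<le> n \<and> \<pi> c < \<pi> b \<and> \<pi> b < \<pi> d \<and> \<pi> d < \<pi> a)"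
  unfolding avoids_length_4
  by (intro arg_cong[where f = Not] iff_exI, rule iffI; elim conjE; intro conjI) simp_all

subsection \<open>Reverse alternating involutions avoiding 4132\<close>

text \<open>For even \<open>m\<close>, the word \<open>m, m-2, m-1, m-4, m-3, \<dots>, 2, 3, 1\<close>.\<close>

definition block :: "nat \<Rightarrow> nat \<Rightarrow> nat" where
  "block m x = (if x = 0 then 0 else if x = 1 then m else if x = m then 1
    else if even x then m - x else m + 2 - x)"

text \<open>The source of 132-avoidance: as position plus value stays between \<open>m\<close> and
  \<open>m + 2\<close>, \<open>b + 2 \<le> d\<close> gives
  \<open>block m d \<le> block m b\<close>.\<close>

lemma block_bounds:
  assumes "even m" "1 \<le> x" "x \<le> m"
  shows "m \<le> block m x + x" "block m x + x \<le> m + 2" "1 \<le> block m x" "block m x \<le> m"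
  using assms by (auto simp: block_def elim!: evenE oddE)

lemma block_block: "even m \<Longrightarrow> x \<le> m \<Longrightarrow> block m (block m x) = x"
  by (auto simp: block_def elim!: evenE oddE)

text \<open>For an involution as in \<open>rai\<close>, these are the left ends of the 2-cycles
  leaving \<open>{1..c}\<close>; the set is empty exactly when \<open>{1..c}\<close> is
  preserved.\<close>

definition crossing :: "(nat \<Rightarrow> nat) \<Rightarrow> nat \<Rightarrow> nat set" where
  "crossing \<pi> c = {x. 1 \<le> x \<and> x \<le> c \<and> c < \<pi> x}"

lemma finite_crossing [simp]: "finite (crossing \<pi> c)"
  by (rule finite_subset[of _ "{1..c}"]) (auto simp: crossing_def)

text \<open>The reverse alternating family in pointwise form. Only 4132 is listed: an involution
  avoids a pattern exactly when it avoids the inverse pattern, and 2431 is regained in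
  \<open>no_2431\<close>.\<close>

locale rai =
  fixes N :: nat and \<pi> :: "nat \<Rightarrow> nat"
  assumes outside: "\<And>x. x \<notin> {1..N} \<Longrightarrow> \<pi> x = x"
    and invol [simp]: "\<And>x. \<pi> (\<pi> x) = x"
    and descent_iff: "\<And>i. 1 \<le> i \<Longrightarrow> i < N \<Longrightarrow> \<pi> (i + 1) < \<pi> i \<longleftrightarrow> odd i"
    and no_4132: "\<And>a b c d. 1 \<le> a \<Longrightarrow> a < b \<Longrightarrow> b < c \<Longrightarrow> c < d \<Longrightarrow> d \<le> N \<Longrightarrow>
      \<pi> b < \<pi> d \<Longrightarrow> \<pi> d < \<pi> c \<Longrightarrow> \<pi> c < \<pi> a \<Longrightarrow> False"
begin

lemma permutes: "\<pi> permutes {1..N}"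
  unfolding permutes_def using outside invol by metis

lemma eq_iff [simp]: "\<pi> x = \<pi> y \<longleftrightarrow> x = y"
  by (metis invol)

lemma range: "1 \<le> x \<Longrightarrow> x \<le> N \<Longrightarrow> 1 \<le> \<pi> x \<and> \<pi> x \<le> N"
  using permutes_in_image[OF permutes, of x] by auto

lemma zero [simp]: "\<pi> 0 = 0"
  using outside by simp

text \<open>Exchanging positions and values turns an occurrence of 2431 into one of 4132.\<close>

lemma no_2431:
  assumes "1 \<le> a" "a < b" "b < c" "c < d" "d \<le> N" "\<pi> d < \<pi> a" "\<pi> a < \<pi> c" "\<pi> c < \<pi> b"
  shows False
  using no_4132[of "\<pi> d" "\<pi> a" "\<pi> c" "\<pi> b"] assms range[of b] range[of d] by simp

lemma descent: "odd i \<Longrightarrow> i < N \<Longrightarrow> \<pi> (i + 1) < \<pi> i"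
  using descent_iff[of i] by (cases i) auto

lemma ascent: "even i \<Longrightarrow> 1 \<le> i \<Longrightarrow> i < N \<Longrightarrow> \<pi> i < \<pi> (i + 1)"
  using descent_iff[of i] eq_iff[of i "i + 1"] by linarith

lemma descent': "even i \<Longrightarrow> 1 \<le> i \<Longrightarrow> i \<le> N \<Longrightarrow> \<pi> i < \<pi> (i - 1)"
  using descent[of "i - 1"] by auto

lemma ascent': "odd i \<Longrightarrow> 2 \<le> i \<Longrightarrow> i \<le> N \<Longrightarrow> \<pi> (i - 1) < \<pi> i"
  using ascent[of "i - 1"] by auto

section \<open>The entries up to the position of 1\<close>

text \<open>Position \<open>\<pi> 1\<close> carries the value 1, which cannot be the upper end of an
  ascent, whereas every odd position after the first is one.\<close>

lemma first_even:
  assumes "2 \<le> N"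
  shows "even (\<pi> 1)" "2 \<le> \<pi> 1" "\<pi> 1 \<le> N"
proof -
  show 2: "2 \<le> \<pi> 1" "\<pi> 1 \<le> N" using descent[of 1] range[of 2] range[of 1] assms by (auto simp: numeral_2_eq_2)
  show "even (\<pi> 1)"
    using ascent'[of "\<pi> 1"] 2 range[of "\<pi> 1 - 1"] by fastforce
qed

text \<open>
  The first entry can serve as the 4 of a forbidden 4132, so the smaller entries avoid 132.
  If \<open>M - 1\<close> were not at position \<open>a\<close>, then the descent of \<open>\<pi>\<close> from \<open>M - 2\<close> to \<open>M - 1\<close> would
  place \<open>M - 1\<close> before \<open>M - 2\<close>, both after the smaller entry \<open>\<pi> a\<close>.
\<close>

lemma step:
  assumes a: "even a" "1 \<le> a" "a < N" and M: "odd M" "3 \<le> M" "M < \<pi> 1"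
    and "a \<le> \<pi> (M - 1)" "\<pi> (a + 1) \<le> M"
  shows "\<pi> a = M - 1" "\<pi> (a + 1) = M"
proof -
  have MN: "M < N" using M range[of 1] a by linarith
  have asc: "\<pi> a < \<pi> (a + 1)" using ascent a by blast
  have 1: "\<pi> (M - 1) = a"
  proof (rule ccontr)
    assume ne: "\<pi> (M - 1) \<noteq> a"
    then have lt: "a < \<pi> (M - 1)" using assms by simp
    have "even (M - 1)" "M - 1 - 1 = M - 2" using M by auto
    then have d: "\<pi> (M - 1) < \<pi> (M - 2)"
      using descent'[of "M - 1"] M MN by auto
    have "\<pi> a \<noteq> M - 1" "\<pi> a \<noteq> M - 2" 
      using ne d lt by (auto dest!: arg_cong[of "\<pi> a" _ \<pi>])
    then have "\<pi> a < M - 2" using asc assms by linarith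
    moreover have "\<pi> (M - 2) \<le> N" using range[of "M - 2"] M MN by auto
    moreover have "M - 2 < M - 1" "M - 1 < \<pi> 1" using M by linarith+
    moreover have "1 < a" using a by (cases "a = 1") auto
    ultimately show False
      using no_4132[of 1 a "\<pi> (M - 1)" "\<pi> (M - 2)"] lt d by simp
  qed
  then show "\<pi> a = M - 1" by (metis invol)
  then show "\<pi> (a + 1) = M" using asc assms by linarith
qed

text \<open>For odd \<open>k < m\<close>, \<open>block m\<close> maps \<open>{1..k}\<close> onto
  \<open>{m - k + 1..m}\<close>. Both maps are involutions, so agreement on the first interval
  forces agreement on the second.\<close>

lemma block_prefix_values:
  assumes m: "even m" and k: "odd k" "k < m" "\<And>x. 1 \<le> x \<Longrightarrow> x \<le> k \<Longrightarrow> \<pi> x = block m x"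
    and y: "m < y + k" "y \<le> m"
  shows "\<pi> y = block m y" "\<pi> y \<le> k"
proof -
  have "block m y \<le> k" "1 \<le> block m y"
    using y k(1,2) m by (auto simp: block_def elim!: evenE oddE) presburger
  moreover from this have "\<pi> (block m y) = y"
    using k(3)[of "block m y"] block_block[of m y] m y by simp
  ultimately show "\<pi> y = block m y" "\<pi> y \<le> k" by (metis invol)+
qed

text \<open>The values up to \<open>k\<close> are exhausted by the positions from
  \<open>m - k + 1\<close> to \<open>m\<close>.\<close>

lemma block_prefix_after:
  assumes m: "even m" and k: "odd k" "k < m" "\<And>x. 1 \<le> x \<Longrightarrow> x \<le> k \<Longrightarrow> \<pi> x = block m x"
    and y: "1 \<le> y" "y + k \<le> m"
  shows "k < \<pi> y"
proof (rule ccontr)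
  assume "\<not> k < \<pi> y"
  moreover have "1 \<le> \<pi> y" using y by (metis One_nat_def Suc_leI eq_iff neq0_conv not_one_le_zero zero)
  ultimately have "y = block m (\<pi> y)" using k(3)[of "\<pi> y"] by simp
  then show False
    using \<open>\<not> k < \<pi> y\<close> \<open>1 \<le> \<pi> y\<close> y m k(1,2)
    by (auto simp: block_def split: if_splits elim!: evenE oddE) presburger
qed

text \<open>Induction over pairs of positions, with \<open>step\<close> supplying the next pair. A
  bound at the odd positions suffices, since each even position is followed by an ascent to an odd
  one.\<close>

lemma block_prefix:
  assumes N: "2 \<le> N" and "odd k" "k < \<pi> 1"
    and "\<And>x. odd x \<Longrightarrow> x \<le> k \<Longrightarrow> \<pi> x \<le> \<pi> 1"
    and "1 \<le> x" "x \<le> k"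
  shows "\<pi> x = block (\<pi> 1) x"
proof -
  define m where "m = \<pi> 1"
  have m: "even m" "2 \<le> m" "m \<le> N" using first_even N by (simp_all add: m_def)
  obtain j where "k = 2 * j + 1" using \<open>odd k\<close> by (elim oddE)
  moreover have "\<pi> x = block m x"
    if "2 * j + 1 < m" "\<And>x. odd x \<Longrightarrow> x \<le> 2 * j + 1 \<Longrightarrow> \<pi> x \<le> m" "1 \<le> x" "x \<le> 2 * j + 1" for j x
    using that
  proof (induction j arbitrary: x)
    case 0
    then have "x = 1" by simp
    then show ?case by (simp add: block_def m_def)
  next
    case (Suc j)
    have IH: "\<pi> x = block m x" if "1 \<le> x" "x \<le> 2 * j + 1" for x
      using Suc that by simp
    define a where "a = 2 * j + 2"
    \<comment> \<open>\<open>M\<close> is the largest value up to \<open>m\<close> that the first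
      \<open>2 * j + 1\<close> positions leave free.\<close>
    define M where "M = m - 2 * j - 1"
    have aM: "even a" "1 \<le> a" "a < N" "odd M" "3 \<le> M" "M < m" "M + a = m + 1"
      using Suc.prems(1) m by (auto simp: a_def M_def)
    have "2 * j + 1 < \<pi> (M - 1)"
      using aM Suc.prems(1) by - (rule block_prefix_after[OF m(1) _ _ IH]; auto simp: M_def)
    then have 1: "a \<le> \<pi> (M - 1)" by (simp add: a_def)
    have "\<pi> (a + 1) \<le> M"
    proof (rule ccontr)
      assume "\<not> ?thesis"
      moreover have "\<pi> (a + 1) \<le> m" using Suc.prems(2)[of "a + 1"] by (simp add: a_def)
      ultimately have "\<pi> (\<pi> (a + 1)) \<le> 2 * j + 1"
        using aM Suc.prems(1) by - (rule block_prefix_values(2)[where k = "2 * j + 1", OF m(1) _ _ IH]; auto simp: M_def)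
      then show False by (simp add: a_def)
    qed
    note st = step[OF aM(1-5) aM(6)[unfolded m_def] 1 this]
    consider "x \<le> 2 * j + 1" | "x = a" | "x = a + 1"
      using Suc.prems(4) by (auto simp: a_def le_Suc_eq)
    then show ?case
    proof cases
      case 1
      then show ?thesis using IH Suc.prems by simp
    next
      case 2
      moreover have "block m a = M - 1" using aM(1-7) by (auto simp: block_def)
      ultimately show ?thesis using st(1) by simp
    next
      case 3
      moreover have "block m (a + 1) = M" using aM(1-7) m(1) by (auto simp: block_def)
      ultimately show ?thesis using st(2) by simp
    qed
  qed
  ultimately show ?thesis using assms(2-) unfolding m_def by blast
qed

text \<open>No position up to \<open>\<pi> 1\<close> has a value above \<open>\<pi> 1\<close>, so
  \<open>block_prefix\<close> applies with \<open>k = \<pi> 1 - 1\<close>; the last position of the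
  block holds 1.\<close>

lemma block_if_not_crossing:
  assumes N: "2 \<le> N" and "crossing \<pi> (\<pi> 1) = {}" and "x \<le> \<pi> 1"
  shows "\<pi> x = block (\<pi> 1) x"
proof -
  note m = first_even[OF N]
  consider "x = 0" | "x = \<pi> 1" | "1 \<le> x" "x \<le> \<pi> 1 - 1" using assms by linarith
  then show ?thesis
  proof cases
    case 3
    show ?thesis
    proof (rule block_prefix[OF N _ _ _ 3])
      fix x assume "odd x" "x \<le> \<pi> 1 - 1"
      then show "\<pi> x \<le> \<pi> 1" using assms(2) by (cases x) (auto simp: crossing_def not_less)
    qed (use m in auto)
  qed (use m in \<open>auto simp: block_def\<close>)
qed

text \<open>The prefix up to \<open>i - 2\<close> is forced, and its inverse fills the last
  \<open>i - 2\<close> of the first \<open>\<pi> 1\<close> positions. Then \<open>i\<close> must be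
  the middle fixed point of the block: a later place is already filled, an earlier one produces
  2431.\<close>

lemma block_if_crossing_singleton:
  assumes N: "2 \<le> N" and cr: "crossing \<pi> (\<pi> 1) = {i}"
  shows "odd i" "\<pi> 1 = 2 * i - 2" "x \<le> \<pi> 1 \<Longrightarrow> x \<noteq> i \<Longrightarrow> \<pi> x = block (\<pi> 1) x"
proof -
  define m where "m = \<pi> 1"
  have m: "even m" "2 \<le> m" "m \<le> N" using first_even N by (simp_all add: m_def)
  have i: "1 \<le> i" "i \<le> m" "m < \<pi> i" using cr by (auto simp: crossing_def m_def)
  have small: "\<pi> x \<le> m" if "x \<le> m" "x \<noteq> i" for x
  proof (cases "x = 0")
    case False
    then have "x \<notin> crossing \<pi> (\<pi> 1)" using cr that by simp
    then show ?thesis using that False by (simp add: crossing_def m_def)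
  qed simp
  have "i \<noteq> 1" using i by (auto simp: m_def)
  \<comment> \<open>At an even \<open>i\<close> the descent from \<open>i - 1\<close> would make
    \<open>i - 1\<close> crossing as well.\<close>
  show "odd i"
  proof
    assume "even i"
    then show False using descent'[of i] small[of "i - 1"] i m by (cases i) auto
  qed
  moreover have "i \<noteq> m" using i by (auto simp: m_def)
  ultimately have i3: "3 \<le> i" "i < m" using i \<open>i \<noteq> 1\<close> by (auto elim: oddE)
  have odd2: "odd (i - 2)" and lt: "i - 2 < m" using \<open>odd i\<close> i3 by auto
  have pre: "\<pi> x = block m x" if "1 \<le> x" "x \<le> i - 2" for x
    unfolding m_def
  proof (rule block_prefix[OF N odd2 _ _ that])
    show "i - 2 < \<pi> 1" using lt by (simp add: m_def)
    show "\<pi> x \<le> \<pi> 1" if "odd x" "x \<le> i - 2" for x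
      using small[of x] that i3 by (simp add: m_def)
  qed
  note vals = block_prefix_values[OF m(1) odd2 lt pre] and aft = block_prefix_after[OF m(1) odd2 lt pre]
  \<comment> \<open>\<open>M\<close> is \<open>block m i\<close>, so \<open>M = i\<close> means that
    the block would fix \<open>i\<close>.\<close>
  define M where "M = m + 2 - i"
  have oddM: "odd M" using \<open>odd i\<close> m(1) i3 by (simp add: M_def)
  have "i \<le> M"
  proof (rule ccontr)
    assume "\<not> i \<le> M"
    then have "\<pi> i \<le> i - 2" using i i3 by - (rule vals; auto simp: M_def)
    then show False using i by linarith
  qed
  have "M = i"
  proof (rule ccontr)
    assume "M \<noteq> i"
    with \<open>i \<le> M\<close> oddM \<open>odd i\<close> have Mi: "i + 2 \<le> M" by (metis Suc_eq_plus1 Suc_leI add_2_eq_Suc' even_Suc le_neq_implies_less)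
    have Mm: "M < m" using i3 by (simp add: M_def)
    have "i - 2 < \<pi> (M - 1)" using i3 by - (rule aft; auto simp: M_def)
    moreover have "\<pi> (M - 1) < \<pi> M" using ascent'[of M] oddM Mi i3 Mm m by auto
    ultimately have "i \<le> \<pi> M" by linarith
    moreover have "\<pi> M \<noteq> i" using small[of M] Mm Mi i by (metis invol le_add1 linorder_not_less less_imp_le_nat not_add_less1 nat_less_le)
    ultimately have q: "i < \<pi> M" by simp
    have qm: "\<pi> M \<le> m" using small[of M] Mm Mi by simp
    have "\<pi> M \<noteq> m" using i3 Mi by (auto simp: m_def)
    then have "\<pi> M < m" "1 \<le> i - 1" "M < \<pi> i" using qm i i3 Mm by simp_all
    have "\<pi> (i - 1) \<le> M"
    proof (rule ccontr)
      assume "\<not> ?thesis"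
      moreover have "\<pi> (i - 1) \<le> m" using small[of "i - 1"] i3 by simp
      ultimately have "\<pi> (\<pi> (i - 1)) \<le> i - 2" using i3 by - (rule vals; auto simp: M_def)
      then show False using i3 by simp
    qed
    moreover have "\<pi> (i - 1) \<noteq> M" using q by (auto dest: arg_cong[of "\<pi> (i - 1)" _ \<pi>])
    moreover have "\<pi> (i - 1) \<noteq> 1"
    proof
      assume "\<pi> (i - 1) = 1"
      then have "i - 1 = m" unfolding m_def by (metis invol)
      then show False using i3 by simp
    qed
    moreover have "1 \<le> \<pi> (i - 1)" using range[of "i - 1"] i3 m by simp
    \<comment> \<open>The positions \<open>i - 1\<close>, \<open>i\<close>, \<open>\<pi> M\<close>,
      \<open>m\<close> carry \<open>\<pi> (i - 1)\<close>, \<open>\<pi> i\<close>, \<open>M\<close>,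
      1, which is a 2431.\<close>
    ultimately show False
      using no_2431[of "i - 1" i "\<pi> M" m] q \<open>\<pi> M < m\<close> \<open>1 \<le> i - 1\<close> \<open>M < \<pi> i\<close> i m by (auto simp: m_def)
  qed
  then show mi: "\<pi> 1 = 2 * i - 2" using i3 by (simp add: M_def m_def)
  show "\<pi> x = block (\<pi> 1) x" if x: "x \<le> \<pi> 1" "x \<noteq> i"
  proof -
    consider "x = 0" | "1 \<le> x" "x \<le> i - 2" | "x = i - 1" | "i < x" using x by linarith
    then show ?thesis
    proof cases
      case 1
      then show ?thesis by (simp add: block_def)
    next
      case 2
      then show ?thesis using pre[of x] unfolding m_def by blast
    next
      case 3
      \<comment> \<open>As \<open>\<pi> 1 = 2 * i - 2\<close>, the prefix and its inverse leave only
        \<open>i - 1\<close> and \<open>i\<close> free, so \<open>i - 1\<close> is a fixed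
        point.\<close>
      have "\<pi> x \<le> i - 1"
      proof (rule ccontr)
        assume "\<not> ?thesis"
        moreover have "\<pi> x \<noteq> i" using i x by (auto simp: m_def dest: arg_cong[of "\<pi> x" _ \<pi>])
        ultimately have "\<pi> (\<pi> x) \<le> i - 2" using i3 mi small[of x] 3 by - (rule vals; auto simp: m_def)
        then show False using 3 i3 by simp
      qed
      moreover have "i - 2 < \<pi> x" using 3 i3 mi by - (rule aft; auto simp: m_def)
      ultimately have "\<pi> x = i - 1" by linarith
      then show ?thesis using 3 i3 mi \<open>odd i\<close> by (auto simp: block_def)
    next
      case 4
      then show ?thesis using vals(1)[of x] x mi i3 unfolding m_def by linarith
    qed
  qed
qed

section \<open>Cycles crossing a cut\<close>

text \<open>
  The entry \<open>c\<close>, at position \<open>\<pi> c\<close> before all crossing positions, and the entry \<open>\<pi> c\<close>, at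
  position \<open>c\<close>, complete forbidden patterns: among the positions up to the end of the first
  crossing cycle, and among the ends of the crossing cycles, \<open>\<pi>\<close> has to be increasing.
\<close>

definition cut :: "nat \<Rightarrow> bool" where
  "cut c \<longleftrightarrow> even c \<and> 1 \<le> c \<and> c \<le> N \<and> \<pi> c < c \<and> crossing \<pi> c \<noteq> {} \<and> (\<forall>x\<in>crossing \<pi> c. \<pi> c < x)"

text \<open>Let \<open>i\<close> be the leftmost crossing position. No value to the right of
  \<open>c\<close> is below \<open>i\<close>, so position \<open>\<pi> i\<close> carries the minimum
  there. If it is odd, alternation allows no position after it and none between \<open>c\<close> and
  it. If it is even, the values strictly between \<open>c\<close> and it increase, so the descent at
  \<open>c + 1\<close> forces \<open>\<pi> i = c + 2\<close>; the cycle of \<open>i\<close> closes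
  and one starting at \<open>c + 1\<close> opens.\<close>

lemma cut_cases:
  assumes "cut c"
  obtains (last) i where "N = c + 1" "crossing \<pi> c = {i}" "\<pi> i = c + 1"
    | (step) i where "c + 2 \<le> N" "i \<in> crossing \<pi> c" "\<pi> i = c + 2" "cut (c + 2)"
      "crossing \<pi> (c + 2) = insert (c + 1) (crossing \<pi> c - {i})"
proof -
  define i where "i = Min (crossing \<pi> c)"
  have c: "even c" "1 \<le> c" "c \<le> N" "\<pi> c < c" "crossing \<pi> c \<noteq> {}"
    using assms by (auto simp: cut_def)
  have pc: "\<pi> c < x" if "x \<in> crossing \<pi> c" for x
    using assms that by (auto simp: cut_def)
  have i: "i \<in> crossing \<pi> c" using c by (simp add: i_def)
  have i_le: "i \<le> x" if "x \<in> crossing \<pi> c" for x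
    using that by (simp add: i_def)
  have i_range: "1 \<le> i" "i \<le> c" "c < \<pi> i" and pi: "\<pi> c < i"
    using i pc by (auto simp: crossing_def)
  have "i \<noteq> c" using i_range c by auto
  have i_N: "\<pi> i \<le> N" using range[of i] i_range c by auto
  have returns: "\<pi> y \<in> crossing \<pi> c" if "c < y" "y \<le> N" "\<pi> y \<le> c" for y
    using that range[of y] by (auto simp: crossing_def)
  have ge_i: "i \<le> \<pi> y" if "c < y" "y \<le> N" for y
    using returns[of y] i_le[of "\<pi> y"] i_range that by (cases "\<pi> y \<le> c") auto
  have p: "1 \<le> \<pi> c" using range c by blast
  \<comment> \<open>Otherwise \<open>c\<close>, \<open>\<pi> x\<close>, \<open>\<pi> y\<close>,
    \<open>i\<close> at positions \<open>\<pi> c\<close>, \<open>x\<close>, \<open>y\<close>,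
    \<open>\<pi> i\<close> form a 2431.\<close>
  have increasing_above: "\<pi> x < \<pi> y" if xy: "1 \<le> x" "x < y" "y < \<pi> i" "c < \<pi> x" "c < \<pi> y" for x y
  proof (rule ccontr)
    assume "\<not> \<pi> x < \<pi> y"
    then have "\<pi> y < \<pi> x" using xy eq_iff[of x y] by linarith
    moreover have "\<pi> c < x"
      using pc[of x] xy c by (cases "x \<le> c") (auto simp: crossing_def)
    ultimately show False
      using no_2431[of "\<pi> c" x y "\<pi> i"] xy p i_N i_range \<open>i \<noteq> c\<close> by simp
  qed
  \<comment> \<open>Otherwise \<open>c\<close>, \<open>\<pi> c\<close>, \<open>\<pi> x\<close>,
    \<open>\<pi> y\<close> at positions \<open>\<pi> c\<close>, \<open>c\<close>, \<open>x\<close>,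
    \<open>y\<close> form a 4132.\<close>
  have increasing_below: "\<pi> x < \<pi> y" if xy: "c < x" "x < y" "y \<le> N" "\<pi> x \<le> c" "\<pi> y \<le> c" for x y
  proof (rule ccontr)
    assume "\<not> \<pi> x < \<pi> y"
    then have "\<pi> y < \<pi> x" using xy eq_iff[of x y] by linarith
    moreover have "\<pi> c < \<pi> y" using pc returns[of y] xy by simp
    moreover have "\<pi> x \<noteq> c" using xy c by (auto dest: arg_cong[of "\<pi> x" _ \<pi>])
    ultimately show False
      using no_4132[of "\<pi> c" c x y] xy p c by simp
  qed
  \<comment> \<open>Otherwise \<open>increasing_below\<close> yields a value below \<open>i\<close>
    to the right of \<open>c\<close>.\<close>
  have above: "c < \<pi> y" if "c < y" "y < \<pi> i" for y
    using increasing_below[of y "\<pi> i"] ge_i[of y] that i_N i_range by force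
  show ?thesis
  proof (cases "odd (\<pi> i)")
    case True
    have "\<pi> i = N"
    proof (rule ccontr)
      assume "\<pi> i \<noteq> N"
      then show False using descent[of "\<pi> i"] ge_i[of "\<pi> i + 1"] True i_N i_range by simp
    qed
    moreover have "\<pi> i = c + 1"
    proof (rule ccontr)
      assume "\<pi> i \<noteq> c + 1"
      then have "c < \<pi> i - 1" "\<pi> i - 1 \<le> N" using i_range i_N by simp_all
      then show False using ascent'[of "\<pi> i"] ge_i[of "\<pi> i - 1"] True i_N i_range by simp
    qed
    moreover have "x = i" if "x \<in> crossing \<pi> c" for x
    proof -
      have "\<pi> x = \<pi> i" using that \<open>\<pi> i = N\<close> \<open>\<pi> i = c + 1\<close> range[of x] by (auto simp: crossing_def)
      then show ?thesis by simp
    qed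
    ultimately show ?thesis using last i by blast
  next
    case False
    have "\<pi> i \<noteq> c + 1" using False c by auto
    have ic: "\<pi> i = c + 2"
    proof (rule ccontr)
      assume "\<pi> i \<noteq> c + 2"
      then have gt: "c + 2 < \<pi> i" using \<open>\<pi> i \<noteq> c + 1\<close> i_range by simp
      then have "\<pi> (c + 1) < \<pi> (c + 2)"
        using above[of "c + 1"] above[of "c + 2"] by (intro increasing_above) auto
      moreover have "\<pi> (c + 2) < \<pi> (c + 1)"
        using descent[of "c + 1"] c gt i_N by simp
      ultimately show False by simp
    qed
    then have cN: "c + 2 \<le> N" using i_N by simp
    have "c < \<pi> (c + 1)" using above ic by simp
    then have "c + 2 < \<pi> (c + 1)"
      using increasing_above[of i "c + 1"] ic i_range by simp
    have cross: "crossing \<pi> (c + 2) = insert (c + 1) (crossing \<pi> c - {i})"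
    proof (intro equalityI subsetI)
      fix x assume x: "x \<in> crossing \<pi> (c + 2)"
      have "\<pi> (c + 2) = i" using ic by (metis invol)
      then have "x \<noteq> c + 2" "x \<noteq> i" using x ic i_range by (auto simp: crossing_def)
      then show "x \<in> insert (c + 1) (crossing \<pi> c - {i})" using x by (auto simp: crossing_def)
    next
      fix x assume x: "x \<in> insert (c + 1) (crossing \<pi> c - {i})"
      show "x \<in> crossing \<pi> (c + 2)"
      proof (cases "x = c + 1")
        case True
        then show ?thesis using \<open>c + 2 < \<pi> (c + 1)\<close> by (simp add: crossing_def)
      next
        case False
        then have x': "1 \<le> x" "x \<le> c" "c < \<pi> x" "x \<noteq> i" using x by (auto simp: crossing_def)
        then have "\<pi> x \<noteq> c + 2" using ic eq_iff[of x i] by metis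
        moreover have "\<pi> x \<noteq> c + 1"
          using \<open>c + 2 < \<pi> (c + 1)\<close> x' by (auto dest: arg_cong[of "\<pi> x" _ \<pi>])
        ultimately show ?thesis using x' by (simp add: crossing_def)
      qed
    qed
    have "\<pi> (c + 2) = i" using ic by (metis invol)
    moreover have "i < x" if "x \<in> crossing \<pi> c - {i}" for x using i_le[of x] that by auto
    ultimately have "cut (c + 2)" using c cN i_range unfolding cut_def cross by auto
    then show ?thesis using step i ic cN cross by blast
  qed
qed

lemma card_crossing_cut: "cut c \<Longrightarrow> card (crossing \<pi> c) = 1"
proof (induction "N - c" arbitrary: c rule: less_induct)
  case less
  from \<open>cut c\<close> show ?case
  proof (cases rule: cut_cases)
    case (step i)
    have "card (insert (c + 1) (crossing \<pi> c - {i})) = 1"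
      unfolding step(5)[symmetric] using step by (intro less) auto
    moreover have "c + 1 \<notin> crossing \<pi> c" by (simp add: crossing_def)
    ultimately show ?thesis using step(2) card_Suc_Diff1[of "crossing \<pi> c" i] by simp
  qed simp
qed

lemma cut_first:
  assumes "2 \<le> N" "crossing \<pi> (\<pi> 1) \<noteq> {}"
  shows "cut (\<pi> 1)"
proof -
  have "1 < x" if "x \<in> crossing \<pi> (\<pi> 1)" for x
    using that by (cases "x = 1") (auto simp: crossing_def)
  then show ?thesis using first_even[OF assms(1)] assms(2) by (auto simp: cut_def)
qed

end

section \<open>Uniqueness in the crossing case\<close>

text \<open>By \<open>cut_cases\<close> the partner of the single crossing position \<open>i\<close>
  is \<open>c + 1\<close> if \<open>N = c + 1\<close> and \<open>c + 2\<close> otherwise, for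
  \<open>\<pi>\<close> and \<open>\<rho>\<close> alike. In the second case the agreement extends to
  \<open>c + 2\<close>, with \<open>c + 1\<close> as the new exception.\<close>

lemma cut_unique:
  assumes "rai N \<pi>" "rai N \<rho>"
  shows "\<lbrakk>rai.cut N \<pi> c; rai.cut N \<rho> c; crossing \<pi> c = {i}; crossing \<rho> c = {i};
    \<And>x. x \<le> c \<Longrightarrow> x \<noteq> i \<Longrightarrow> \<pi> x = \<rho> x\<rbrakk> \<Longrightarrow> \<pi> = \<rho>"
proof (induction "N - c" arbitrary: c i rule: less_induct)
  case less
  interpret p: rai N \<pi> by fact
  interpret r: rai N \<rho> by fact
  from less.prems(1) show ?case
  proof (cases rule: p.cut_cases)
    case (last j)
    from less.prems(2) have ri: "\<rho> i = c + 1"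
      by (cases rule: r.cut_cases) (use last less.prems in auto)
    show ?thesis
    proof
      fix x
      have pi: "\<pi> i = c + 1" using last less.prems by auto
      consider "x = i" | "x = c + 1" | "x \<le> c" "x \<noteq> i" | "N < x" using last by linarith
      then show "\<pi> x = \<rho> x"
        by cases (use pi ri less.prems p.invol[of i] r.invol[of i] p.outside[of x] r.outside[of x] in auto)
    qed
  next
    case (step j)
    have pi: "\<pi> i = c + 2" using step less.prems by auto
    from less.prems(2) show ?thesis
    proof (cases rule: r.cut_cases)
      case last
      then show ?thesis using step by simp
    next
      case step': (step k)
      have ri: "\<rho> i = c + 2" using step' less.prems by auto
      show ?thesis
      proof (rule less.hyps[of "c + 2" "c + 1"])
        fix x assume "x \<le> c + 2" "x \<noteq> c + 1"
        then consider "x = c + 2" | "x = i" | "x \<le> c" "x \<noteq> i" by linarith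
        then show "\<pi> x = \<rho> x"
          by cases (use pi ri less.prems p.invol[of i] r.invol[of i] in auto)
      qed (use step step' less.prems(3,4) in auto)
    qed
  qed
qed

lemma (in rai) crossing_first:
  assumes "2 \<le> N" "crossing \<pi> (\<pi> 1) \<noteq> {}"
  shows "4 dvd \<pi> 1" "crossing \<pi> (\<pi> 1) = {\<pi> 1 div 2 + 1}"
proof -
  obtain i where i: "crossing \<pi> (\<pi> 1) = {i}"
    using card_crossing_cut[OF cut_first[OF assms]] by (auto simp: card_1_singleton_iff)
  note i' = block_if_crossing_singleton(1,2)[OF assms(1) i]
  then show "4 dvd \<pi> 1" by (elim oddE) simp
  show "crossing \<pi> (\<pi> 1) = {\<pi> 1 div 2 + 1}" using i i' by (elim oddE) simp
qed

lemma crossing_unique: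
  assumes "rai N \<pi>" "rai N \<rho>" and N: "2 \<le> N" and eq: "\<pi> 1 = \<rho> 1"
    and "crossing \<pi> (\<pi> 1) \<noteq> {}" "crossing \<rho> (\<rho> 1) \<noteq> {}"
  shows "\<pi> = \<rho>"
proof -
  interpret p: rai N \<pi> by fact
  interpret r: rai N \<rho> by fact
  note ps = p.crossing_first(2)[OF N assms(5)] and rs = r.crossing_first(2)[OF N assms(6)]
  show ?thesis
  proof (rule cut_unique[OF assms(1,2) p.cut_first[OF N assms(5)] _ ps])
    show "rai.cut N \<rho> (\<pi> 1)" using r.cut_first[OF N assms(6)] eq by simp
    show "crossing \<rho> (\<pi> 1) = {\<pi> 1 div 2 + 1}" using rs eq by simp
    show "\<pi> x = \<rho> x" if "x \<le> \<pi> 1" "x \<noteq> \<pi> 1 div 2 + 1" for x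
      using p.block_if_crossing_singleton(3)[OF N ps that]
        r.block_if_crossing_singleton(3)[OF N rs, of x] that eq by simp
  qed
qed

subsection \<open>Constructions\<close>

text \<open>If \<open>4 dvd m\<close>, then \<open>m/2 + 1\<close> is a fixed point of \<open>block m\<close>.\<close>

definition released_block :: "nat \<Rightarrow> nat \<Rightarrow> nat" where
  "released_block m x = (if x = m div 2 + 1 then m + 1 else if x = m + 1 then m div 2 + 1
    else if x \<le> m then block m x else x)"

text \<open>A 4132 would end in a 132 that avoids position \<open>m div 2 + 1\<close>, where the
  maximum stands. Inside the block \<open>block_bounds\<close> excludes this. If
  \<open>d = m + 1\<close>, with value \<open>m div 2 + 1\<close>, the same bounds force
  \<open>c \<le> m div 2 \<le> b\<close>.\<close>

lemma rai_released_block: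
  assumes m: "4 dvd m" "0 < m"
  shows "rai (m + 1) (released_block m)"
proof -
  obtain k where k: "m = 4 * k" "1 \<le> k" using m by (auto elim!: dvdE)
  let ?i = "2 * k + 1"
  have fi: "released_block m ?i = m + 1" and fN: "released_block m (m + 1) = ?i"
    and f: "\<And>x. x \<le> m \<Longrightarrow> x \<noteq> ?i \<Longrightarrow> released_block m x = block m x"
    and out: "\<And>x. m + 1 < x \<Longrightarrow> released_block m x = x"
    by (auto simp: released_block_def k)
  have "even m" using k by simp
  have bi: "block m ?i = ?i" using k by (auto simp: block_def)
  have bne: "block m x \<noteq> ?i" if "x \<le> m" "x \<noteq> ?i" for x
    using block_block[OF \<open>even m\<close> that(1)] bi that(2) by metis
  have bm: "block m x \<le> m" if "x \<le> m" for x
    using that block_bounds(4)[OF \<open>even m\<close>, of x] by (cases x) (auto simp: block_def)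
  show ?thesis
  proof
    fix x assume "x \<notin> {1..m + 1}"
    then have "x = 0 \<or> m + 1 < x" by auto
    then show "released_block m x = x" using f[of 0] out by (auto simp: block_def)
  next
    fix x
    consider "x = ?i" | "x = m + 1" | "x \<le> m" "x \<noteq> ?i" | "m + 1 < x" by linarith
    then show "released_block m (released_block m x) = x"
    proof cases
      case 3
      then show ?thesis
        using f[OF 3] f[OF bm[OF 3(1)] bne[OF 3]] block_block[OF \<open>even m\<close> 3(1)] by simp
    qed (use fi fN out in auto)
  next
    fix j assume j: "1 \<le> j" "j < m + 1"
    consider "j = ?i" | "j + 1 = ?i" | "j = m" | "j \<noteq> ?i" "j + 1 \<noteq> ?i" "j < m" using j by linarith
    then show "released_block m (j + 1) < released_block m j \<longleftrightarrow> odd j"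
    proof cases
      case 1
      then have "released_block m (j + 1) < m + 1" using f[of "j + 1"] bm[of "j + 1"] k by auto
      then show ?thesis using 1 fi by simp
    next
      case 2
      then have "released_block m j < m + 1" "even j" using f[of j] bm[of j] k by auto
      then show ?thesis using 2 fi by simp
    next
      case 3
      then show ?thesis using fN f[of m] k by (simp add: block_def)
    next
      case 4
      then show ?thesis using f[of j] f[of "j + 1"] j \<open>even m\<close> by (auto simp: block_def elim!: evenE oddE)
    qed
  next
    fix a b c d
    assume pos: "1 \<le> a" "a < b" "b < c" "c < d" "d \<le> m + 1"
      and val: "released_block m b < released_block m d" "released_block m d < released_block m c"
        "released_block m c < released_block m a"
    have "released_block m a \<le> m + 1"
      using f[of a] fi bm[of a] pos by (cases "a = ?i") auto
    then have "b \<noteq> ?i" "c \<noteq> ?i" "d \<noteq> ?i" using val fi by auto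
    then have bc: "released_block m b = block m b" "released_block m c = block m c" using f pos by auto
    note bounds = block_bounds[OF \<open>even m\<close>, of b] block_bounds[OF \<open>even m\<close>, of c] block_bounds[OF \<open>even m\<close>, of d]
    show False
    proof (cases "d = m + 1")
      case True
      then show ?thesis using val bc fN bounds(1,6) pos k by auto
    next
      case False
      then have "released_block m d = block m d" using f \<open>d \<noteq> ?i\<close> pos by auto
      then show ?thesis using val bc bounds pos False by auto
    qed
  qed
qed

text \<open>The new 2-cycle \<open>(N N+2)\<close> is inserted around the old last point, which moves to \<open>N+1\<close>.\<close>

definition extend :: "nat \<Rightarrow> (nat \<Rightarrow> nat) \<Rightarrow> nat \<Rightarrow> nat" where
  "extend N f x = (if x = N then N + 2 else if x = N + 1 then f N else if x = N + 2 then N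
    else if f x = N then N + 1 else f x)"

text \<open>Position \<open>N\<close> carries the maximum and so could only begin a 4132, but too
  few positions follow it. Position \<open>N + 2\<close> could only end one, but its value
  \<open>N\<close> is exceeded only by \<open>N + 1\<close> and by that maximum. Any other
  occurrence comes from one in \<open>f\<close>.\<close>

lemma rai_extend:
  assumes "rai N f" and N: "odd N" and "f N \<noteq> N"
  shows "rai (N + 2) (extend N f)"
proof -
  interpret rai N f by fact
  have fN: "1 \<le> f N" "f N < N" using range[of N] N assms(3) by (cases N, auto)+
  have le: "f x \<le> N" if "x \<le> N" for x using range[of x] that by (cases x) auto
  have small: "extend N f x = (if f x = N then N + 1 else f x)" if "x < N" for x
    using that by (simp add: extend_def)
  have big: "extend N f N = N + 2" "extend N f (N + 1) = f N" "extend N f (N + 2) = N"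
    by (simp_all add: extend_def)
  show ?thesis
  proof
    fix x assume "x \<notin> {1..N + 2}"
    then have "x = 0 \<or> N + 2 < x" by auto
    then show "extend N f x = x" using fN outside[of x] by (auto simp: extend_def)
  next
    fix x
    consider "x = N" | "x = N + 1" | "x = N + 2" | "x = f N" "x < N" | "x < N" "x \<noteq> f N" | "N + 2 < x"
      by linarith
    then show "extend N f (extend N f x) = x"
    proof cases
      case 5
      then have "f x \<noteq> N" by auto
      moreover have "f x < N" using le[of x] 5 calculation by simp
      ultimately show ?thesis using 5 small by simp
    next
      case 6
      then show ?thesis using outside[of x] by (simp add: extend_def)
    qed (use fN big small[of "f N"] in auto)
  next
    fix i assume i: "1 \<le> i" "i < N + 2"
    consider "i + 1 < N" | "i + 1 = N" | "i = N" | "i = N + 1" using i by linarith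
    then show "extend N f (i + 1) < extend N f i \<longleftrightarrow> odd i"
    proof cases
      case 1
      then show ?thesis
        using descent_iff[of i] i small[of i] small[of "i + 1"] le[of i] le[of "i + 1"] by auto
    next
      case 2
      then show ?thesis using small[of i] le[of i] big N by auto
    next
      case 3
      then show ?thesis using big N fN by simp
    next
      case 4
      have "N + 1 + 1 = N + 2" by simp
      show ?thesis unfolding 4 \<open>N + 1 + 1 = N + 2\<close> big using N fN by simp
    qed
  next
    fix a b c d
    assume pos: "1 \<le> a" "a < b" "b < c" "c < d" "d \<le> N + 2"
      and val: "extend N f b < extend N f d" "extend N f d < extend N f c" "extend N f c < extend N f a"
    have top: "extend N f x \<le> N + 1" if "x \<le> N + 2" "x \<noteq> N" for x
      using that le[of x] fN by (auto simp: extend_def)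
    have "a \<noteq> N" using pos by auto
    then have a: "extend N f a \<le> N + 1" using top pos by simp
    then have "b \<noteq> N" "c \<noteq> N" "d \<noteq> N" using val big by auto
    moreover have "d \<noteq> N + 2" using val a big by auto
    ultimately have d: "d < N \<or> d = N + 1" using pos by linarith
    then have abc: "a < N" "b < N" "c < N" using pos \<open>c \<noteq> N\<close> by auto
    \<comment> \<open>\<open>e\<close> is the position of \<open>f\<close> that moves to
      \<open>d\<close>: the old last position \<open>N\<close> becomes \<open>N + 1\<close>.\<close>
    define e where "e = (if d < N then d else N)"
    have "extend N f d = (if f e = N then N + 1 else f e)" "c < e" "e \<le> N"
      using d small[of d] big fN abc pos by (auto simp: e_def)
    then show False
      using no_4132[of a b c e] pos val abc small le[of a] le[of b] le[of c] le[of e]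
      by (auto split: if_splits)
  qed
qed

text \<open>Start with the released block at length \<open>m + 1\<close> and extend \<open>t\<close>
  times; the last conjunct is what \<open>rai_extend\<close> requires for the next
  extension.\<close>

lemma ex_crossing:
  assumes m: "4 dvd m" "0 < m"
  shows "\<exists>\<pi>. rai (m + 1 + 2 * t) \<pi> \<and> \<pi> 1 = m \<and> crossing \<pi> m \<noteq> {} \<and> \<pi> (m + 1 + 2 * t) \<noteq> m + 1 + 2 * t"
proof (induction t)
  case 0
  have "2 < m" using m by (auto elim!: dvdE)
  then have "released_block m 1 = m" by (auto simp: released_block_def block_def)
  moreover have "m div 2 + 1 \<in> crossing (released_block m) m"
    using \<open>2 < m\<close> by (auto simp: crossing_def released_block_def)
  moreover have "released_block m (m + 1) \<noteq> m + 1"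
    using \<open>2 < m\<close> by (auto simp: released_block_def)
  ultimately show ?case using rai_released_block[OF m] by auto
next
  case (Suc t)
  let ?N = "m + 1 + 2 * t"
  obtain \<pi> where \<pi>: "rai ?N \<pi>" "\<pi> 1 = m" "crossing \<pi> m \<noteq> {}" "\<pi> ?N \<noteq> ?N" using Suc by blast
  have "odd ?N" using m by (auto elim!: dvdE)
  then have "rai (?N + 2) (extend ?N \<pi>)" using rai_extend \<pi> by blast
  moreover have "extend ?N \<pi> 1 = m" using \<pi>(2) m by (simp add: extend_def)
  moreover have "crossing \<pi> m \<subseteq> crossing (extend ?N \<pi>) m"
    by (auto simp: crossing_def extend_def)
  moreover have "extend ?N \<pi> (?N + 2) \<noteq> ?N + 2" by (simp add: extend_def)
  moreover have "?N + 2 = m + 1 + 2 * Suc t" by simp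
  ultimately show ?case using \<pi>(3) by (metis subset_empty)
qed

section \<open>Direct sums with a leading block\<close>

definition block_sum :: "nat \<Rightarrow> (nat \<Rightarrow> nat) \<Rightarrow> nat \<Rightarrow> nat" where
  "block_sum m \<sigma> x = (if x \<le> m then block m x else \<sigma> (x - m) + m)"

text \<open>The first entry of a 4132 is its largest, so an occurrence starting in the block stays
  there, and the block has no 132; any other lies in the copy of \<open>\<sigma>\<close>. As
  \<open>m\<close> is even, the shift keeps the parity of positions.\<close>

lemma rai_block_sum:
  assumes "rai K \<sigma>" and m: "even m" "0 < m"
  shows "rai (K + m) (block_sum m \<sigma>)"
proof -
  interpret rai K \<sigma> by fact
  have le: "block m x \<le> m" if "x \<le> m" for x
    using that block_bounds(4)[OF m(1), of x] by (cases x) (auto simp: block_def)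
  have gt: "m < block_sum m \<sigma> x" if "m < x" for x
  proof -
    have "\<sigma> (x - m) \<noteq> 0" using that eq_iff[of "x - m" 0] by simp
    then show ?thesis using that by (simp add: block_sum_def)
  qed
  have le': "block_sum m \<sigma> x \<le> m" if "x \<le> m" for x using that le by (simp add: block_sum_def)
  show ?thesis
  proof
    fix x assume "x \<notin> {1..K + m}"
    then have "x = 0 \<or> K + m < x" by auto
    moreover have "\<sigma> (x - m) = x - m" if "K + m < x" by (rule outside) (use that in auto)
    ultimately show "block_sum m \<sigma> x = x" by (auto simp: block_sum_def block_def)
  next
    fix x
    show "block_sum m \<sigma> (block_sum m \<sigma> x) = x"
    proof (cases "x \<le> m")
      case True
      then show ?thesis using le block_block[OF m(1)] by (simp add: block_sum_def)
    next
      case False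
      then show ?thesis using gt[of x] by (simp add: block_sum_def)
    qed
  next
    fix i assume i: "1 \<le> i" "i < K + m"
    consider "i < m" | "i = m" | "m < i" by linarith
    then show "block_sum m \<sigma> (i + 1) < block_sum m \<sigma> i \<longleftrightarrow> odd i"
    proof cases
      case 1
      then show ?thesis using i m by (auto simp: block_sum_def block_def elim!: evenE oddE)
    next
      case 2
      then show ?thesis using le'[of m] gt[of "m + 1"] m by simp
    next
      case 3
      then have "i + 1 - m = (i - m) + 1" "odd (i - m) \<longleftrightarrow> odd i" using m by auto
      then show ?thesis using descent_iff[of "i - m"] 3 i by (simp add: block_sum_def)
    qed
  next
    fix a b c d
    assume pos: "1 \<le> a" "a < b" "b < c" "c < d" "d \<le> K + m"
      and val: "block_sum m \<sigma> b < block_sum m \<sigma> d" "block_sum m \<sigma> d < block_sum m \<sigma> c"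
        "block_sum m \<sigma> c < block_sum m \<sigma> a"
    show False
    proof (cases "a \<le> m")
      case True
      then have "d \<le> m" using le'[of a] gt[of d] val by linarith
      then show ?thesis
        using val pos block_bounds[OF m(1), of b] block_bounds[OF m(1), of c] block_bounds[OF m(1), of d]
        by (simp add: block_sum_def)
    next
      case False
      then have "1 \<le> a - m" "a - m < b - m" "b - m < c - m" "c - m < d - m" "d - m \<le> K"
        using pos by linarith+
      from no_4132[OF this] show ?thesis
        using val pos False by (simp add: block_sum_def)
    qed
  qed
qed

text \<open>An empty crossing set makes \<open>{1..m}\<close> invariant. There
  \<open>block_if_not_crossing\<close> determines \<open>\<pi>\<close>, and the rest, shifted down
  by \<open>m\<close>, inherits all conditions.\<close>

lemma rai_remove_block:
  assumes "rai (K + m) \<pi>" and m: "even m" "0 < m"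
    and first: "\<pi> 1 = m" "crossing \<pi> m = {}"
  shows "\<exists>\<sigma>. rai K \<sigma> \<and> \<pi> = block_sum m \<sigma>"
proof -
  interpret rai "K + m" \<pi> by fact
  define \<sigma> where "\<sigma> x = (if x = 0 then 0 else \<pi> (x + m) - m)" for x
  have le: "\<pi> x \<le> m" if "x \<le> m" for x
  proof (cases "x = 0")
    case False
    then have "x \<notin> crossing \<pi> m" using first by simp
    then show ?thesis using that False by (simp add: crossing_def)
  qed simp
  have gt: "m < \<pi> x" if "m < x" for x
    using le[of "\<pi> x"] that by (cases "\<pi> x \<le> m") auto
  have \<sigma>: "\<pi> (x + m) = \<sigma> x + m" if "0 < x" for x
    using gt[of "x + m"] that by (simp add: \<sigma>_def)
  have pos: "0 < \<sigma> x" if "0 < x" for x using gt[of "x + m"] that by (simp add: \<sigma>_def)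
  have "rai K \<sigma>"
  proof
    fix x assume "x \<notin> {1..K}"
    then show "\<sigma> x = x" using outside[of "x + m"] by (auto simp: \<sigma>_def)
  next
    fix x
    show "\<sigma> (\<sigma> x) = x"
    proof (cases "x = 0")
      case False
      then have "\<sigma> (\<sigma> x) + m = x + m" using \<sigma>[of x] \<sigma>[of "\<sigma> x"] pos[of x] by (metis invol neq0_conv)
      then show ?thesis by simp
    qed (simp add: \<sigma>_def)
  next
    fix i assume "1 \<le> i" "i < K"
    then show "\<sigma> (i + 1) < \<sigma> i \<longleftrightarrow> odd i"
      using descent_iff[of "i + m"] \<sigma>[of i] \<sigma>[of "i + 1"] m by (simp add: add_ac)
  next
    fix a b c d
    assume "1 \<le> a" "a < b" "b < c" "c < d" "d \<le> K" "\<sigma> b < \<sigma> d" "\<sigma> d < \<sigma> c" "\<sigma> c < \<sigma> a"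
    then show False
      using no_4132[of "a + m" "b + m" "c + m" "d + m"] \<sigma>[of a] \<sigma>[of b] \<sigma>[of c] \<sigma>[of d] by simp
  qed
  moreover have "\<pi> x = block_sum m \<sigma> x" for x
  proof (cases "x \<le> m")
    case True
    have "2 \<le> K + m" using m by (auto elim!: evenE)
    then have "\<pi> x = block m x" using block_if_not_crossing[of x] first True by simp
    then show ?thesis using True by (simp add: block_sum_def)
  next
    case False
    then show ?thesis using \<sigma>[of "x - m"] by (simp add: block_sum_def)
  qed
  ultimately show ?thesis by blast
qed

lemma card_not_crossing:
  assumes m: "even m" "0 < m"
  shows "card {\<pi>. rai (K + m) \<pi> \<and> \<pi> 1 = m \<and> crossing \<pi> m = {}} = card {\<sigma>. rai K \<sigma>}"
proof -
  have "{\<pi>. rai (K + m) \<pi> \<and> \<pi> 1 = m \<and> crossing \<pi> m = {}} = block_sum m ` {\<sigma>. rai K \<sigma>}"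
  proof (intro equalityI subsetI)
    fix \<pi> assume "\<pi> \<in> block_sum m ` {\<sigma>. rai K \<sigma>}"
    then obtain \<sigma> where \<sigma>: "rai K \<sigma>" "\<pi> = block_sum m \<sigma>" by auto
    have "\<pi> 1 = m" using m by (auto simp: \<sigma> block_sum_def block_def)
    moreover have "crossing \<pi> m = {}"
      using block_bounds(4)[OF m(1)] by (auto simp: crossing_def \<sigma> block_sum_def not_less)
    ultimately show "\<pi> \<in> {\<pi>. rai (K + m) \<pi> \<and> \<pi> 1 = m \<and> crossing \<pi> m = {}}"
      using rai_block_sum \<sigma> m by simp
  next
    fix \<pi> assume "\<pi> \<in> {\<pi>. rai (K + m) \<pi> \<and> \<pi> 1 = m \<and> crossing \<pi> m = {}}"
    then show "\<pi> \<in> block_sum m ` {\<sigma>. rai K \<sigma>}" using rai_remove_block[of K m \<pi>] m by blast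
  qed
  moreover have "inj_on (block_sum m) {\<sigma>. rai K \<sigma>}"
  proof (intro inj_onI ext)
    fix \<sigma> \<tau> x assume h: "\<sigma> \<in> {\<sigma>. rai K \<sigma>}" "\<tau> \<in> {\<sigma>. rai K \<sigma>}" "block_sum m \<sigma> = block_sum m \<tau>"
    show "\<sigma> x = \<tau> x"
    proof (cases "x = 0")
      case True
      then show ?thesis using h by (simp add: rai.zero)
    next
      case False
      then show ?thesis using fun_cong[OF h(3), of "x + m"] by (simp add: block_sum_def)
    qed
  qed
  ultimately show ?thesis by (simp add: card_image)
qed

subsection \<open>Counting\<close>

lemma finite_rai: "finite {\<pi>. rai N \<pi>}"
  by (rule finite_subset[OF _ finite_permutations[OF finite_atLeastAtMost]]) (blast intro: rai.permutes)

text \<open>For \<open>4 dvd m\<close>, \<open>ex_crossing\<close> and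
  \<open>crossing_unique\<close> give exactly one permutation; otherwise
  \<open>crossing_first\<close> leaves none.\<close>

lemma card_crossing:
  assumes m: "even m" "0 < m" "m < N" and N: "odd N"
  shows "card {\<pi>. rai N \<pi> \<and> \<pi> 1 = m \<and> crossing \<pi> m \<noteq> {}} = (if 4 dvd m then 1 else 0)"
proof (cases "4 dvd m")
  case True
  have N2: "2 \<le> N" using m by simp
  obtain t where "N = m + 1 + 2 * t"
  proof
    show "N = m + 1 + 2 * ((N - m - 1) div 2)" using m N by (auto elim!: evenE oddE)
  qed
  then obtain \<pi> where \<pi>: "rai N \<pi>" "\<pi> 1 = m" "crossing \<pi> m \<noteq> {}"
    using ex_crossing[OF True m(2), of t] by blast
  have "{\<pi>. rai N \<pi> \<and> \<pi> 1 = m \<and> crossing \<pi> m \<noteq> {}} = {\<pi>}"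
  proof (intro equalityI subsetI)
    fix \<rho> assume "\<rho> \<in> {\<pi>. rai N \<pi> \<and> \<pi> 1 = m \<and> crossing \<pi> m \<noteq> {}}"
    then have "rai N \<rho>" "\<rho> 1 = m" "crossing \<rho> m \<noteq> {}" by auto
    then show "\<rho> \<in> {\<pi>}" using crossing_unique[of N \<rho> \<pi>] \<pi> N2 by auto
  qed (use \<pi> in auto)
  then show ?thesis using True by simp
next
  case False
  then have "{\<pi>. rai N \<pi> \<and> \<pi> 1 = m \<and> crossing \<pi> m \<noteq> {}} = {}"
    using rai.crossing_first(1)[of N] m by fastforce
  then show ?thesis using False by (simp only: card.empty if_False)
qed

text \<open>The permutations are sorted by \<open>\<pi> 1 = 2 * j\<close>. The first summand comes
  from removing the leading block, the second from the crossing case, which needs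
  \<open>4 dvd 2 * j\<close>.\<close>

lemma card_rai_sum:
  "card {\<pi>. rai (2 * n + 1) \<pi>} =
    (if n = 0 then 1 else (\<Sum>j\<in>{1..n}. card {\<pi>. rai (2 * (n - j) + 1) \<pi>} + (if even j then 1 else 0)))"
proof (cases "n = 0")
  case True
  have "rai 1 id" by unfold_locales auto
  moreover have "\<pi> = id" if "rai 1 \<pi>" for \<pi>
  proof
    interpret rai 1 \<pi> by fact
    fix x
    show "\<pi> x = id x" using outside[of x] range[of 1] by (cases "x = 1") auto
  qed
  ultimately have "{\<pi>. rai 1 \<pi>} = {id}" by auto
  then show ?thesis using True by simp
next
  case False
  let ?N = "2 * n + 1"
  let ?P = "\<lambda>j. {\<pi>. rai ?N \<pi> \<and> \<pi> 1 = 2 * j}"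
  have "{\<pi>. rai ?N \<pi>} = (\<Union>j\<in>{1..n}. ?P j)"
  proof (intro equalityI subsetI)
    fix \<pi> assume "\<pi> \<in> {\<pi>. rai ?N \<pi>}"
    then interpret rai ?N \<pi> by simp
    have "2 \<le> ?N" using False by simp
    from first_even[OF this] obtain j where "\<pi> 1 = 2 * j" "2 \<le> 2 * j" "2 * j \<le> ?N" by (auto elim!: evenE)
    then have "\<pi> 1 = 2 * j" "j \<in> {1..n}" by auto
    then show "\<pi> \<in> (\<Union>j\<in>{1..n}. ?P j)" using rai_axioms by blast
  qed auto
  moreover have "finite (?P j)" for j by (rule finite_subset[OF _ finite_rai[of ?N]]) auto
  ultimately have "card {\<pi>. rai ?N \<pi>} = (\<Sum>j\<in>{1..n}. card (?P j))"
    by (simp only:) (rule card_UN_disjoint; auto)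
  also have "\<dots> = (\<Sum>j\<in>{1..n}. card {\<pi>. rai (2 * (n - j) + 1) \<pi>} + (if even j then 1 else 0))"
  proof (rule sum.cong[OF refl])
    fix j assume j: "j \<in> {1..n}"
    let ?A = "{\<pi>. rai ?N \<pi> \<and> \<pi> 1 = 2 * j \<and> crossing \<pi> (2 * j) = {}}"
    let ?B = "{\<pi>. rai ?N \<pi> \<and> \<pi> 1 = 2 * j \<and> crossing \<pi> (2 * j) \<noteq> {}}"
    have "finite ?A" "finite ?B" by (rule finite_subset[OF _ finite_rai[of ?N]]; auto)+
    moreover have "?P j = ?A \<union> ?B" "?A \<inter> ?B = {}" by auto
    ultimately have "card (?P j) = card ?A + card ?B" by (simp only: card_Un_disjoint)
    moreover have "j \<le> n" using j by simp
    then have "?N = 2 * (n - j) + 1 + 2 * j" by linarith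
    then have "card ?A = card {\<pi>. rai (2 * (n - j) + 1) \<pi>}"
      using card_not_crossing[of "2 * j" "2 * (n - j) + 1"] j by (simp only:) simp
    moreover have "card ?B = (if 4 dvd 2 * j then 1 else 0)"
      using j by (intro card_crossing) auto
    moreover have "4 dvd 2 * j \<longleftrightarrow> even j" by presburger
    ultimately show "card (?P j) = card {\<pi>. rai (2 * (n - j) + 1) \<pi>} + (if even j then 1 else 0)"
      by simp
  qed
  finally show ?thesis using False by simp
qed

text \<open>The sum for \<open>Suc n\<close> contains the whole sum for \<open>n\<close>, which is
  again the count for \<open>n\<close>. At \<open>n = 0\<close> the count 1 is an initial value not
  given by the sum, so the one-step recurrence starts at \<open>n = 1\<close>.\<close>

lemma card_rai_Suc:
  assumes "1 \<le> n"
  shows "card {\<pi>. rai (2 * Suc n + 1) \<pi>} =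
    2 * card {\<pi>. rai (2 * n + 1) \<pi>} + (if odd n then 1 else 0)"
proof -
  define r where "r n = card {\<pi>. rai (2 * n + 1) \<pi>}" for n
  define e where "e j = (if even j then 1 else 0 :: nat)" for j :: nat
  have r: "r k = sum r {..<k} + sum e {1..k}" if "1 \<le> k" for k
  proof -
    have "r k = (\<Sum>j\<in>{1..k}. r (k - j)) + sum e {1..k}"
      using card_rai_sum[of k] that by (simp add: r_def e_def sum.distrib)
    also have "(\<Sum>j\<in>{1..k}. r (k - j)) = sum r {..<k}"
      by (rule sum.reindex_bij_witness[of _ "\<lambda>i. k - i" "\<lambda>i. k - i"]) auto
    finally show ?thesis .
  qed
  have "r (Suc n) = 2 * r n + e (Suc n)"
    using r[of n] r[of "Suc n"] assms by simp
  then show ?thesis by (simp add: r_def e_def)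
qed

text \<open>The added 2 or 1 is the remainder of \<open>5 * 2 ^ (n - 1)\<close> modulo 3; this is
  the floor formula freed from division.\<close>

lemma card_rai:
  assumes "1 \<le> n"
  shows "3 * card {\<pi>. rai (2 * n + 1) \<pi>} + (if odd n then 2 else 1) = 5 * 2 ^ (n - 1)"
  using assms
proof (induction n rule: dec_induct)
  case base
  show ?case using card_rai_sum[of 1] card_rai_sum[of 0] by simp
next
  case (step n)
  then have "(2::nat) ^ n = 2 * 2 ^ (n - 1)" by (cases n) auto
  then show ?case using step.IH card_rai_Suc[OF step.hyps(1)] by (auto split: if_splits)
qed

subsection \<open>Alternating involutions\<close>

lemma involutions_iff:
  "\<pi> \<in> involutions N \<longleftrightarrow> (\<forall>x. x \<notin> {1..N} \<longrightarrow> \<pi> x = x) \<and> (\<forall>x. \<pi> (\<pi> x) = x)" (is "_ \<longleftrightarrow> ?R")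
proof
  assume "\<pi> \<in> involutions N"
  then have "\<pi> permutes {1..N}" "\<pi> = inv \<pi>" by (auto simp: involutions_def)
  then show ?R using permutes_inverses(1)[of \<pi> "{1..N}"] permutes_not_in by metis
next
  assume R: ?R
  then have "\<pi> permutes {1..N}" unfolding permutes_def by metis
  moreover have "inv \<pi> = \<pi>" using R by (intro inv_equality) auto
  ultimately show "\<pi> \<in> involutions N" by (simp add: involutions_def)
qed

lemma involutions_inj: "\<pi> \<in> involutions N \<Longrightarrow> \<pi> x = \<pi> y \<longleftrightarrow> x = y"
  by (metis involutions_iff)

lemma RAI_eq_rai: "RAI N [2, 4, 3, 1] [4, 1, 3, 2] = {\<pi>. rai N \<pi>}"
proof (intro equalityI subsetI)
  fix \<pi> assume "\<pi> \<in> {\<pi>. rai N \<pi>}"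
  then interpret rai N \<pi> by simp
  show "\<pi> \<in> RAI N [2, 4, 3, 1] [4, 1, 3, 2]"
    unfolding RAI_def mem_Collect_eq involutions_iff avoids_2431 avoids_4132 reverse_alternating_def
    using outside descent_iff no_4132 no_2431 by (auto; blast)
next
  fix \<pi> assume "\<pi> \<in> RAI N [2, 4, 3, 1] [4, 1, 3, 2]"
  then have out: "\<forall>x. x \<notin> {1..N} \<longrightarrow> \<pi> x = x" and inv: "\<forall>x. \<pi> (\<pi> x) = x"
    and ra: "reverse_alternating N \<pi>" and av: "avoids N \<pi> [4, 1, 3, 2]"
    unfolding RAI_def involutions_iff by blast+
  have "rai N \<pi>"
  proof
    show "\<pi> (i + 1) < \<pi> i \<longleftrightarrow> odd i" if "1 \<le> i" "i < N" for i
      using ra that by (auto simp: reverse_alternating_def)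
  qed (use out inv av[unfolded avoids_4132] in blast)+
  then show "\<pi> \<in> {\<pi>. rai N \<pi>}" by simp
qed

section \<open>Reverse-complement\<close>

definition reverse_complement :: "nat \<Rightarrow> (nat \<Rightarrow> nat) \<Rightarrow> nat \<Rightarrow> nat" where
  "reverse_complement N \<pi> x = (if x \<in> {1..N} then N + 1 - \<pi> (N + 1 - x) else x)"

lemma involutions_range:
  assumes "\<pi> \<in> involutions N" "x \<in> {1..N}"
  shows "\<pi> x \<in> {1..N}"
  using assms permutes_in_image[of \<pi> "{1..N}" x] by (auto simp: involutions_def)

lemma reverse_complement_involutions:
  assumes "\<pi> \<in> involutions N"
  shows "reverse_complement N \<pi> \<in> involutions N"
    "reverse_complement N (reverse_complement N \<pi>) = \<pi>"
proof -
  have flip: "N + 1 - (N + 1 - x) = x" if "x \<in> {1..N}" for x using that by auto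
  have in_range: "N + 1 - x \<in> {1..N}" if "x \<in> {1..N}" for x using that by auto
  have r: "\<pi> (N + 1 - x) \<in> {1..N}" if "x \<in> {1..N}" for x
    using involutions_range[OF assms in_range[OF that]] .
  have "reverse_complement N \<pi> (reverse_complement N \<pi> x) = x" for x
    using assms r[of x] in_range[OF r[of x]] flip[of x] flip[OF r[of x]]
    by (auto simp: reverse_complement_def involutions_iff)
  then show "reverse_complement N \<pi> \<in> involutions N"
    by (simp add: involutions_iff reverse_complement_def)
  show "reverse_complement N (reverse_complement N \<pi>) = \<pi>"
  proof
    fix x
    show "reverse_complement N (reverse_complement N \<pi>) x = \<pi> x"
    proof (cases "x \<in> {1..N}")
      case True
      then show ?thesis
        using flip[OF involutions_range[OF assms True]] flip[of x] in_range[of x]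
        by (simp only: reverse_complement_def if_True)
    next
      case False
      then have "\<pi> x = x" using assms unfolding involutions_iff by blast
      then show ?thesis by (simp only: reverse_complement_def False if_False)
    qed
  qed
qed

lemma reverse_complement_less:
  assumes "\<pi> \<in> involutions N" "x \<in> {1..N}" "y \<in> {1..N}"
  shows "reverse_complement N \<pi> x < reverse_complement N \<pi> y \<longleftrightarrow> \<pi> (N + 1 - y) < \<pi> (N + 1 - x)"
proof -
  have "N + 1 - x \<in> {1..N}" "N + 1 - y \<in> {1..N}" using assms(2,3) by auto
  then have "\<pi> (N + 1 - x) \<in> {1..N}" "\<pi> (N + 1 - y) \<in> {1..N}"
    using involutions_range[OF assms(1)] by blast+
  moreover have "reverse_complement N \<pi> x = N + 1 - \<pi> (N + 1 - x)"
    "reverse_complement N \<pi> y = N + 1 - \<pi> (N + 1 - y)"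
    using assms by (simp_all only: reverse_complement_def if_True)
  ultimately show ?thesis unfolding atLeastAtMost_iff by linarith
qed

text \<open>A descent at \<open>N - i\<close> becomes a descent at \<open>i\<close>, and for odd
  \<open>N\<close> these indices have opposite parity. Reverse-complement carries 4132 to 3241 and
  2431 to 4213.\<close>

lemma reverse_complement_RAI:
  assumes N: "odd N" and \<pi>: "\<pi> \<in> RAI N [2, 4, 3, 1] [4, 1, 3, 2]"
  shows "reverse_complement N \<pi> \<in> AI N [3, 2, 4, 1] [4, 2, 1, 3]"
proof -
  have inv: "\<pi> \<in> involutions N" and ra: "reverse_alternating N \<pi>"
    and av: "avoids N \<pi> [2, 4, 3, 1]" "avoids N \<pi> [4, 1, 3, 2]"
    using \<pi> by (auto simp: RAI_def)
  note less = reverse_complement_less[OF inv]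
  have "alternating N (reverse_complement N \<pi>)"
    unfolding alternating_def
  proof
    fix i assume i: "i \<in> {1..<N}"
    have "\<pi> (N - i + 1) < \<pi> (N - i) \<longleftrightarrow> odd (N - i)"
      using ra[unfolded reverse_alternating_def] by (rule bspec) (use i in auto)
    moreover have "odd (N - i) \<longleftrightarrow> even i" using i N by auto
    moreover have "\<pi> (N - i + 1) \<noteq> \<pi> (N - i)"
      by (simp add: involutions_inj[OF inv])
    ultimately have "\<pi> (N - i) < \<pi> (N - i + 1) \<longleftrightarrow> odd i" by linarith
    then show "reverse_complement N \<pi> i < reverse_complement N \<pi> (i + 1) \<longleftrightarrow> odd i"
      using less[of i "i + 1"] i by (simp add: Suc_diff_le)
  qed
  moreover have "avoids N (reverse_complement N \<pi>) [3, 2, 4, 1]"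
    unfolding avoids_3241
  proof (rule notI, elim exE conjE)
    fix a b c d assume h: "1 \<le> a" "a < b" "b < c" "c < d" "d \<le> N"
      "reverse_complement N \<pi> d < reverse_complement N \<pi> b"
      "reverse_complement N \<pi> b < reverse_complement N \<pi> a"
      "reverse_complement N \<pi> a < reverse_complement N \<pi> c"
    show False
      using av(2)[unfolded avoids_4132]
      apply (rule notE)
      apply (rule exI[of _ "N + 1 - d"], rule exI[of _ "N + 1 - c"], rule exI[of _ "N + 1 - b"], rule exI[of _ "N + 1 - a"])
      using h by (auto simp: less)
  qed
  moreover have "avoids N (reverse_complement N \<pi>) [4, 2, 1, 3]"
    unfolding avoids_4213
  proof (rule notI, elim exE conjE)
    fix a b c d assume h: "1 \<le> a" "a < b" "b < c" "c < d" "d \<le> N"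
      "reverse_complement N \<pi> c < reverse_complement N \<pi> b"
      "reverse_complement N \<pi> b < reverse_complement N \<pi> d"
      "reverse_complement N \<pi> d < reverse_complement N \<pi> a"
    show False
      using av(1)[unfolded avoids_2431]
      apply (rule notE)
      apply (rule exI[of _ "N + 1 - d"], rule exI[of _ "N + 1 - c"], rule exI[of _ "N + 1 - b"], rule exI[of _ "N + 1 - a"])
      using h by (auto simp: less)
  qed
  ultimately show ?thesis using reverse_complement_involutions(1)[OF inv] by (simp add: AI_def)
qed

lemma reverse_complement_AI:
  assumes N: "odd N" and \<pi>: "\<pi> \<in> AI N [3, 2, 4, 1] [4, 2, 1, 3]"
  shows "reverse_complement N \<pi> \<in> RAI N [2, 4, 3, 1] [4, 1, 3, 2]"
proof -
  have inv: "\<pi> \<in> involutions N" and alt: "alternating N \<pi>"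
    and av: "avoids N \<pi> [3, 2, 4, 1]" "avoids N \<pi> [4, 2, 1, 3]"
    using \<pi> by (auto simp: AI_def)
  note less = reverse_complement_less[OF inv]
  have "reverse_alternating N (reverse_complement N \<pi>)"
    unfolding reverse_alternating_def
  proof
    fix i assume i: "i \<in> {1..<N}"
    have "\<pi> (N - i) < \<pi> (N - i + 1) \<longleftrightarrow> odd (N - i)"
      using alt[unfolded alternating_def] by (rule bspec) (use i in auto)
    moreover have "odd (N - i) \<longleftrightarrow> even i" using i N by auto
    moreover have "\<pi> (N - i + 1) \<noteq> \<pi> (N - i)"
      by (simp add: involutions_inj[OF inv])
    ultimately have "\<pi> (N - i + 1) < \<pi> (N - i) \<longleftrightarrow> odd i" by linarith
    then show "reverse_complement N \<pi> (i + 1) < reverse_complement N \<pi> i \<longleftrightarrow> odd i"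
      using less[of "i + 1" i] i by (simp add: Suc_diff_le)
  qed
  moreover have "avoids N (reverse_complement N \<pi>) [2, 4, 3, 1]"
    unfolding avoids_2431
  proof (rule notI, elim exE conjE)
    fix a b c d assume h: "1 \<le> a" "a < b" "b < c" "c < d" "d \<le> N"
      "reverse_complement N \<pi> d < reverse_complement N \<pi> a"
      "reverse_complement N \<pi> a < reverse_complement N \<pi> c"
      "reverse_complement N \<pi> c < reverse_complement N \<pi> b"
    show False
      using av(2)[unfolded avoids_4213]
      apply (rule notE)
      apply (rule exI[of _ "N + 1 - d"], rule exI[of _ "N + 1 - c"], rule exI[of _ "N + 1 - b"], rule exI[of _ "N + 1 - a"])
      using h by (auto simp: less)
  qed
  moreover have "avoids N (reverse_complement N \<pi>) [4, 1, 3, 2]"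
    unfolding avoids_4132
  proof (rule notI, elim exE conjE)
    fix a b c d assume h: "1 \<le> a" "a < b" "b < c" "c < d" "d \<le> N"
      "reverse_complement N \<pi> b < reverse_complement N \<pi> d"
      "reverse_complement N \<pi> d < reverse_complement N \<pi> c"
      "reverse_complement N \<pi> c < reverse_complement N \<pi> a"
    show False
      using av(1)[unfolded avoids_3241]
      apply (rule notE)
      apply (rule exI[of _ "N + 1 - d"], rule exI[of _ "N + 1 - c"], rule exI[of _ "N + 1 - b"], rule exI[of _ "N + 1 - a"])
      using h by (auto simp: less)
  qed
  ultimately show ?thesis using reverse_complement_involutions(1)[OF inv] by (simp add: RAI_def)
qed

lemma card_RAI_eq_card_AI:
  assumes "odd N"
  shows "card (RAI N [2, 4, 3, 1] [4, 1, 3, 2]) = card (AI N [3, 2, 4, 1] [4, 2, 1, 3])"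
proof -
  have "bij_betw (reverse_complement N) (RAI N [2, 4, 3, 1] [4, 1, 3, 2]) (AI N [3, 2, 4, 1] [4, 2, 1, 3])"
    using reverse_complement_RAI[OF assms] reverse_complement_AI[OF assms]
    by (intro bij_betw_byWitness[where f' = "reverse_complement N"])
      (auto simp: reverse_complement_involutions(2) RAI_def AI_def)
  then show ?thesis by (rule bij_betw_same_card)
qed

theorem theorem9p2:
  fixes n :: nat
  assumes "n \<ge> 1"
  shows "card (RAI (2 * n + 1) [2, 4, 3, 1] [4, 1, 3, 2]) = card (AI (2 * n + 1) [3, 2, 4, 1] [4, 2, 1, 3])
    \<and> int (card (AI (2 * n + 1) [3, 2, 4, 1] [4, 2, 1, 3])) = \<lfloor>2 ^ (n - 1) * 5 / (3 :: real)\<rfloor>"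
proof
  show eq: "card (RAI (2 * n + 1) [2, 4, 3, 1] [4, 1, 3, 2]) = card (AI (2 * n + 1) [3, 2, 4, 1] [4, 2, 1, 3])"
    by (rule card_RAI_eq_card_AI) simp
  define r where "r = card {\<pi>. rai (2 * n + 1) \<pi>}"
  have "3 * r + (if odd n then 2 else 1) = 5 * 2 ^ (n - 1)"
    unfolding r_def by (rule card_rai[OF assms])
  \<comment> \<open>The remainder 1 or 2 places \<open>5 * 2 ^ (n - 1) / 3\<close> strictly between
    \<open>r\<close> and \<open>r + 1\<close>.\<close>
  then have "real (3 * r + (if odd n then 2 else 1)) = real (5 * 2 ^ (n - 1))" by (rule arg_cong)
  then have "\<lfloor>2 ^ (n - 1) * 5 / (3 :: real)\<rfloor> = int r"
    by (intro floor_unique) (auto split: if_splits)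
  moreover have "card (AI (2 * n + 1) [3, 2, 4, 1] [4, 2, 1, 3]) = r"
    unfolding eq[symmetric] RAI_eq_rai r_def by (rule refl)
  ultimately show "int (card (AI (2 * n + 1) [3, 2, 4, 1] [4, 2, 1, 3])) = \<lfloor>2 ^ (n - 1) * 5 / (3 :: real)\<rfloor>"
    by (simp only:)
qed

end
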